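(* Let $G$ be a cubic graph. If there exists a set $S \subseteq V(G)$ such that $G-S$ is acyclic with $c$ connected components, then \[\operatorname{Z}(G) \le \alpha(G) + \beta(G[S]) + c.\]
   Context: All graphs are simple, finite and undirected. A graph is cubic if it is $3$-regular. For $S\subseteq V(G)$, $G-S$ is the subgraph induced by $V(G)\setminus S$ and $G[S]$ is the subgraph induced by $S$. $\alpha(G)$ is the independence number of $G$. $\beta(G)$ is the vertex cover number: the minimum number of vertices in a set that meets every edge of $G$. Zero forcing: given a set $B\subseteq V(G)$ of initially blue vertices (the rest white), if a blue vertex has exactly one white neighbor $w$, it can force $w$ to become blue; this rule is applied repeatedly. $B$ is a zero forcing set if all vertices can eventually become blue. $\operatorname{Z}(G)$ is the minimum cardinality of a zero forcing set of $G$. *)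

theory Defs
  imports "Graph_Theory.Digraph_Component"
begin

text \<open>
  A finite simple undirected graph is a digraph in the locale \<^locale>\<open>graph\<close>: finite, symmetric,
  without loops and without parallel arcs. An undirected edge is thus a pair of opposite arcs, the
  edges being given by \<^const>\<open>dominates\<close>.
\<close>

text \<open>In a symmetric digraph without parallel arcs the out-degree is the undirected degree.\<close>

definition cubic :: "('a, 'b) pre_digraph \<Rightarrow> bool" where
  "cubic G \<longleftrightarrow> (\<forall>v \<in> verts G. out_degree G v = 3)"

text \<open>
  The library predicate \<^const>\<open>forest\<close> is not usable for symmetric digraphs: it counts an edge
  traversed back and forth as a cycle of length 2. In a simple graph the undirected cycles are the
  cycles of length at least 3.
\<close>

definition acyclic_graph :: "('a, 'b) pre_digraph \<Rightarrow> bool" where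
  "acyclic_graph G \<longleftrightarrow> \<not> (\<exists>p. pre_digraph.cycle G p \<and> 3 \<le> length p)"

definition components :: "('a, 'b) pre_digraph \<Rightarrow> ('a, 'b) pre_digraph set" where
  "components G = {H. pre_digraph.max_subgraph G connected H}"

text \<open>
  In a symmetric digraph the maximal connected subgraphs are the strongly connected components,
  which gives access to the library's results about \<^const>\<open>pre_digraph.sccs\<close>.
\<close>

lemma strongly_connected_imp_connected:
  assumes "strongly_connected H" shows "connected H"
proof -
  have "rtrancl_on (verts H) (arcs_ends H) \<subseteq> rtrancl_on (verts H) ((arcs_ends H)\<^sup>s)"
    by (auto intro: rtrancl_on_mono[where s = "arcs_ends H"] simp: symcl_def)
  with assms show ?thesis
    unfolding connected_conv strongly_connected_def reachable_def by blast
qed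

lemma (in sym_digraph) connected_subgraph_induce:
  assumes "subgraph H G" and "connected H"
  shows "strongly_connected (G \<restriction> verts H)"
proof -
  interpret I: wf_digraph "G \<restriction> verts H" by (rule wellformed_induce_subgraph)
  have "subgraph H (G \<restriction> verts H)"
    using assms(1) by (auto intro: subgraph_induce_subgraphI2)
  then have "connected (G \<restriction> verts H)"
    using assms(2) by (intro I.connected_spanning_imp_connected[of H]) (auto simp: spanning_def)
  moreover have "symmetric (G \<restriction> verts H)"
    using sym_arcs unfolding symmetric_conv by fastforce
  ultimately show ?thesis
    by (intro I.symmetric_connected_imp_strongly_connected)
qed

lemma (in sym_digraph) components_eq_sccs: "components G = sccs"
proof -
  have "max_subgraph connected H \<longleftrightarrow> max_subgraph strongly_connected H" for H
  proof
    assume H: "max_subgraph connected H"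
    then have sub: "subgraph H G" "connected H" by (auto simp: max_subgraph_def)
    from connected_subgraph_induce[OF sub] have sc: "strongly_connected (G \<restriction> verts H)" .
    have "subgraph H (G \<restriction> verts H)" "subgraph (G \<restriction> verts H) G"
      using sub(1) by (auto intro: subgraph_induce_subgraphI2 subgraph_induce_subgraphI)
    with H sc have "H = G \<restriction> verts H"
      unfolding max_subgraph_def by (metis strongly_connected_imp_connected)
    with sc have "strongly_connected H" by simp
    with H show "max_subgraph strongly_connected H"
      unfolding max_subgraph_def by (metis strongly_connected_imp_connected)
  next
    assume H: "max_subgraph strongly_connected H"
    show "max_subgraph connected H"
      unfolding max_subgraph_def
    proof (intro conjI allI impI notI)
      show "subgraph H G" "connected H"
        using H by (auto simp: max_subgraph_def strongly_connected_imp_connected)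
      fix H' assume A: "H' \<noteq> H \<and> subgraph H H'" and B: "subgraph H' G \<and> connected H'"
      have sc: "strongly_connected (G \<restriction> verts H')"
        using B by (auto intro: connected_subgraph_induce)
      have s: "subgraph H' (G \<restriction> verts H')" "subgraph (G \<restriction> verts H') G"
        using B by (auto intro: subgraph_induce_subgraphI2 subgraph_induce_subgraphI)
      then have "subgraph H (G \<restriction> verts H')"
        using A by (auto intro: subgraph_trans)
      with H sc s have "H = G \<restriction> verts H'"
        unfolding max_subgraph_def by metis
      with s A show False
        by (auto simp: subgraph_def compatible_def intro!: pre_digraph.equality)
    qed
  qed
  then show ?thesis by (simp add: components_def sccs_altdef2)
qed

definition independent_set :: "('a, 'b) pre_digraph \<Rightarrow> 'a set \<Rightarrow> bool" where
  "independent_set G I \<longleftrightarrow> I \<subseteq> verts G \<and> (\<forall>u \<in> I. \<forall>v \<in> I. \<not> u \<rightarrow>\<^bsub>G\<^esub> v)"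

definition independence_number :: "('a, 'b) pre_digraph \<Rightarrow> nat" where
  "independence_number G = Max (card ` {I. independent_set G I})"

definition vertex_cover :: "('a, 'b) pre_digraph \<Rightarrow> 'a set \<Rightarrow> bool" where
  "vertex_cover G C \<longleftrightarrow> C \<subseteq> verts G \<and> (\<forall>u v. u \<rightarrow>\<^bsub>G\<^esub> v \<longrightarrow> u \<in> C \<or> v \<in> C)"

definition vertex_cover_number :: "('a, 'b) pre_digraph \<Rightarrow> nat" where
  "vertex_cover_number G = Min (card ` {C. vertex_cover G C})"

text \<open>One application of the colour change rule, from blue set \<open>B\<close> to blue set \<open>B'\<close>.\<close>

definition force_step :: "('a, 'b) pre_digraph \<Rightarrow> 'a set \<Rightarrow> 'a set \<Rightarrow> bool" where
  "force_step G B B' \<longleftrightarrow> (\<exists>u \<in> B. \<exists>w. {v. u \<rightarrow>\<^bsub>G\<^esub> v \<and> v \<notin> B} = {w} \<and> B' = insert w B)"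

definition zero_forcing_set :: "('a, 'b) pre_digraph \<Rightarrow> 'a set \<Rightarrow> bool" where
  "zero_forcing_set G B \<longleftrightarrow> B \<subseteq> verts G \<and> (force_step G)\<^sup>*\<^sup>* B (verts G)"

definition zero_forcing_number :: "('a, 'b) pre_digraph \<Rightarrow> nat" where
  "zero_forcing_number G = Min (card ` {B. zero_forcing_set G B})"

end

theory Submission
  imports Defs
begin

text \<open>
  Write \<open>F\<close> for the set of vertices outside \<open>S\<close>. Colouring all of \<open>S\<close> blue and adding a set \<open>B\<close>
  that forces the forest induced by \<open>F\<close> gives a zero forcing set of \<open>G\<close>, because forces between
  vertices of \<open>F\<close> are not disturbed by neighbours that are blue from the start. If \<open>C\<close> is a minimum
  vertex cover of the graph induced by \<open>S\<close>, then \<open>S - C\<close> is independent, so the cost is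
  \<open>|S| + |B| = \<beta> + |S - C| + |B|\<close>.

  It remains to pay for \<open>B\<close> with the components of the forest and with vertices that can be added
  to \<open>S - C\<close> while keeping it independent. The suitable vertices are those that have all three of
  their neighbours in \<open>F\<close>: they have no neighbour in \<open>S\<close> at all. So everything follows from a
  statement about a forest \<open>X\<close> of maximum degree 3 with \<open>c\<close> components
  (\<open>subcubic_forest_forcing\<close>): it has a zero forcing set of size at most \<open>|J| + c\<close> for some
  independent set \<open>J\<close> of vertices that have degree 3 in \<open>X\<close>. Then \<open>(S - C) \<union> J\<close> is independent in \<open>G\<close>
  and \<open>|S| + |B| \<le> \<beta> + |(S - C) \<union> J| + c \<le> \<beta> + \<alpha> + c\<close>.

  The forest statement is proved by pruning. A nonempty subcubic forest contains an isolated vertex,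
  or a leaf whose neighbour has degree at most 2, or a vertex of degree 3 with two leaf
  neighbours (\<open>one_degenerate_cases\<close>). An isolated vertex is added to \<open>B\<close> and paid for by its
  component. A leaf next to a vertex of degree at most 2 only prolongs a forcing chain and costs
  nothing. In the third case the vertex \<open>p\<close> and its two leaves are removed together; one leaf is
  added to \<open>B\<close> and \<open>p\<close> to \<open>J\<close>. The remaining neighbour of \<open>p\<close> has lost a neighbour, so it never enters
  \<open>J\<close> afterwards, which keeps \<open>J\<close> independent.

  Only two consequences of the forest structure enter. Acyclicity is used as 1-degeneracy, the
  existence of a vertex of degree at most 1 in every nonempty induced subgraph, and the components
  are represented by a set \<open>R\<close> of vertices no two of which are connected.
\<close>

section \<open>Graphs as symmetric relations\<close>

definition nbrs :: "('a \<Rightarrow> 'a \<Rightarrow> bool) \<Rightarrow> 'a set \<Rightarrow> 'a \<Rightarrow> 'a set" where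
  "nbrs E X v = {w \<in> X. E v w}"

text \<open>
  \<open>B\<close> is a zero forcing set of the graph induced by \<open>X\<close>. Instead of a sequence of forces, the
  formulation says that the colour change rule is never stuck: every proper superset of \<open>B\<close>, whether
  reachable or not, admits a force. This is equivalent, since the reachable blue sets are supersets of
  \<open>B\<close>, and the final blue set does not shrink when more vertices start blue.
\<close>

definition forces_all :: "('a \<Rightarrow> 'a \<Rightarrow> bool) \<Rightarrow> 'a set \<Rightarrow> 'a set \<Rightarrow> bool" where
  "forces_all E X B \<longleftrightarrow>
     B \<subseteq> X \<and> (\<forall>K. B \<subseteq> K \<longrightarrow> K \<subset> X \<longrightarrow> (\<exists>u\<in>K. \<exists>w. nbrs E (X - K) u = {w}))"

definition linked :: "('a \<Rightarrow> 'a \<Rightarrow> bool) \<Rightarrow> 'a set \<Rightarrow> 'a \<Rightarrow> 'a \<Rightarrow> bool" where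
  "linked E X = (\<lambda>u v. u \<in> X \<and> v \<in> X \<and> E u v)\<^sup>*\<^sup>*"

text \<open>
  The vertices of \<open>R\<close> lie in pairwise different components, so \<open>|R|\<close> is a lower bound for the number of
  components. This is the direction that is needed, and it spares counting components while the graph is
  pruned.
\<close>

definition separated :: "('a \<Rightarrow> 'a \<Rightarrow> bool) \<Rightarrow> 'a set \<Rightarrow> 'a set \<Rightarrow> bool" where
  "separated E X R \<longleftrightarrow> R \<subseteq> X \<and> (\<forall>a\<in>R. \<forall>b\<in>R. linked E X a b \<longrightarrow> a = b)"

text \<open>
  The independent sets of branch vertices with which forcing sets are paid for. In a cubic graph a
  vertex with three neighbours in \<open>X\<close> has no neighbour outside \<open>X\<close>.
\<close>

definition branch_set :: "('a \<Rightarrow> 'a \<Rightarrow> bool) \<Rightarrow> 'a set \<Rightarrow> 'a set \<Rightarrow> bool" where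
  "branch_set E X J \<longleftrightarrow>
     J \<subseteq> X \<and> (\<forall>v\<in>J. card (nbrs E X v) = 3) \<and> (\<forall>u\<in>J. \<forall>v\<in>J. \<not> E u v)"

text \<open>
  For finite simple graphs this characterises forests, and it is visibly inherited by induced
  subgraphs.
\<close>

definition one_degenerate :: "('a \<Rightarrow> 'a \<Rightarrow> bool) \<Rightarrow> 'a set \<Rightarrow> bool" where
  "one_degenerate E X \<longleftrightarrow> (\<forall>Y\<subseteq>X. Y \<noteq> {} \<longrightarrow> (\<exists>v\<in>Y. card (nbrs E Y v) \<le> 1))"

lemma forces_allD:
  assumes "forces_all E X B" "B \<subseteq> K" "K \<subset> X"
  obtains u w where "u \<in> K" "nbrs E (X - K) u = {w}"
  using assms unfolding forces_all_def by blast

lemma nbrs_subset: "nbrs E X v \<subseteq> X"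
  by (auto simp: nbrs_def)

lemma finite_nbrs: "finite X \<Longrightarrow> finite (nbrs E X v)"
  by (simp add: nbrs_def)

lemma card_nbrs_mono: "Y \<subseteq> X \<Longrightarrow> finite X \<Longrightarrow> card (nbrs E Y v) \<le> card (nbrs E X v)"
  by (intro card_mono finite_nbrs) (auto simp: nbrs_def)

lemma nbrs_eqI:
  assumes "finite X" "card (nbrs E X v) \<le> 1" "p \<in> X" "E v p"
  shows "nbrs E X v = {p}"
proof -
  have "p \<in> nbrs E X v" using assms by (auto simp: nbrs_def)
  moreover have "is_singleton (nbrs E X v)"
    using assms calculation finite_nbrs[OF assms(1), of E v]
    by (metis One_nat_def card_0_eq empty_iff is_singleton_altdef le_antisym less_one not_le)
  ultimately show ?thesis by (auto simp: is_singleton_def)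
qed

section \<open>Pruning leaves and isolated vertices\<close>

text \<open>
  A walk can visit a vertex \<open>l\<close> with at most one neighbour only by a detour from that neighbour and
  back, which can be cut out. For the induction along the walk the second conjunct records
  where the walk is when it currently rests at \<open>l\<close>.
\<close>

lemma linked_remove_leaf:
  assumes sym: "symp E" and irr: "irreflp E" and "finite X" "card (nbrs E X l) \<le> 1"
    and "linked E X a b" "a \<noteq> l"
  shows "(b \<noteq> l \<longrightarrow> linked E (X - {l}) a b) \<and>
         (b = l \<longrightarrow> (\<forall>p\<in>X. E l p \<longrightarrow> linked E (X - {l}) a p))"
  using assms(5) unfolding linked_def
proof (induction rule: rtranclp_induct)
  case base
  then show ?case using \<open>a \<noteq> l\<close> by simp
next
  case (step b c)
  show ?case
  proof (cases "c = l")
    case True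
    then have "E l b" "b \<noteq> l" using step.hyps(2) sym irr by (auto dest: sympD irreflpD)
    moreover have "p = b" if "p \<in> X" "E l p" for p
      using nbrs_eqI[OF assms(3,4)] that \<open>E l b\<close> step.hyps(2) by (metis singleton_inject)
    ultimately show ?thesis using step.IH True by blast
  next
    case False
    show ?thesis
    proof (cases "b = l")
      case True
      then show ?thesis using step False by auto
    next
      case bl: False
      then have "b \<in> X - {l} \<and> c \<in> X - {l} \<and> E b c" using step.hyps(2) False by auto
      moreover note step.IH bl False
      ultimately show ?thesis by (metis (no_types, lifting) rtranclp.rtrancl_into_rtrancl)
    qed
  qed
qed

lemma separated_add_leaf:
  assumes "symp E" "irreflp E" "finite X" "card (nbrs E X l) \<le> 1" "separated E (X - {l}) R"
  shows "separated E X R"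
proof -
  have "a = b" if "a \<in> R" "b \<in> R" "linked E X a b" for a b
  proof -
    have "a \<noteq> l" "b \<noteq> l" using that assms(5) by (auto simp: separated_def)
    then have "linked E (X - {l}) a b"
      using linked_remove_leaf[OF assms(1-4) that(3)] by blast
    then show ?thesis using that assms(5) by (auto simp: separated_def)
  qed
  then show ?thesis using assms(5) by (auto simp: separated_def)
qed

lemma separated_add_isolated:
  assumes "symp E" "irreflp E" "finite X" "l \<in> X" "nbrs E X l = {}" "separated E (X - {l}) R"
  shows "separated E X (insert l R)"
proof -
  have R: "separated E X R" using assms by (intro separated_add_leaf[of E X l R]) auto
  have no: "\<not> (l \<in> X \<and> p \<in> X \<and> E l p)" "\<not> (p \<in> X \<and> l \<in> X \<and> E p l)" for p
    using assms(1,5) by (auto simp: nbrs_def dest: sympD)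
  have 1: "b = l" if "linked E X l b" for b
    using that unfolding linked_def by (cases rule: converse_rtranclpE) (use no in auto)
  have 2: "a = l" if "linked E X a l" for a
    using that unfolding linked_def by (cases rule: rtranclp.cases) (use no in auto)
  from R 1 2 assms(4) show ?thesis unfolding separated_def by blast
qed

lemma branch_set_mono:
  assumes "branch_set E Y J" "Y \<subseteq> X" "finite X" "\<forall>v\<in>X. card (nbrs E X v) \<le> 3"
  shows "branch_set E X J"
  unfolding branch_set_def
proof (intro conjI ballI)
  fix v assume "v \<in> J"
  then have "card (nbrs E Y v) = 3" "v \<in> X" using assms by (auto simp: branch_set_def)
  then show "card (nbrs E X v) = 3"
    using card_nbrs_mono[OF assms(2,3), of E v] assms(4) by fastforce
qed (use assms in \<open>auto simp: branch_set_def\<close>)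

lemma forces_all_add_isolated:
  assumes "l \<in> X" "forces_all E (X - {l}) B"
  shows "forces_all E X (insert l B)"
  unfolding forces_all_def
proof (intro conjI allI impI)
  show "insert l B \<subseteq> X" using assms by (auto simp: forces_all_def)
  fix K assume K: "insert l B \<subseteq> K" "K \<subset> X"
  then have "B \<subseteq> K - {l}" "K - {l} \<subset> X - {l}" 
    using assms by (auto simp: forces_all_def)
  then obtain u w where "u \<in> K" "nbrs E (X - {l} - (K - {l})) u = {w}"
    using forces_allD[OF assms(2)] by (metis Diff_iff)
  moreover have "X - {l} - (K - {l}) = X - K" using K by auto
  ultimately show "\<exists>u\<in>K. \<exists>w. nbrs E (X - K) u = {w}" by auto
qed

text \<open>
  Prolonging a chain at its end \<open>p\<close> by a new leaf \<open>l\<close> costs nothing. If \<open>p\<close> starts blue, start \<open>l\<close>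
  blue in its place and let it force \<open>p\<close>. Otherwise \<open>p\<close> becomes blue through its only other
  neighbour; then \<open>p\<close> has only \<open>l\<close> left to force.
\<close>

lemma forces_all_extend_leaf:
  assumes sym: "symp E" and irr: "irreflp E" and fin: "finite X"
    and lX: "l \<in> X" and nl: "nbrs E X l = {p}"
    and dp: "card (nbrs E X p) \<le> 2" and B: "forces_all E (X - {l}) B"
  shows "\<exists>B'. forces_all E X B' \<and> card B' = card B"
proof -
  have p: "p \<in> X" "E l p" "E p l" "p \<noteq> l"
    using nl sym irr by (auto simp: nbrs_def dest: sympD irreflpD)
  have BX: "B \<subseteq> X - {l}" and finB: "finite B"
    using B fin by (auto simp: forces_all_def intro: finite_subset)
  have only: "E v l \<Longrightarrow> v \<in> X \<Longrightarrow> v = p" for v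
    using nl sym by (auto simp: nbrs_def dest: sympD)
  show ?thesis
  proof (cases "p \<in> B")
    case True
    let ?B = "insert l (B - {p})"
    have "forces_all E X ?B" unfolding forces_all_def
    proof (intro conjI allI impI)
      show "?B \<subseteq> X" using BX lX by auto
      fix K assume K: "?B \<subseteq> K" "K \<subset> X"
      show "\<exists>u\<in>K. \<exists>w. nbrs E (X - K) u = {w}"
      proof (cases "p \<in> K")
        case True
        then have "insert l B \<subseteq> K" using K by auto
        then show ?thesis
          using forces_all_add_isolated[OF lX B] K(2) unfolding forces_all_def by blast
      next
        case False
        then have "nbrs E (X - K) l = {p}" using nl by (auto simp: nbrs_def)
        then show ?thesis using K by blast
      qed
    qed
    moreover have "card ?B = card B"
    proof -
      have "l \<notin> B - {p}" "finite (B - {p})" using BX finB by auto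
      then show ?thesis using card_Suc_Diff1[OF finB True] by simp
    qed
    ultimately show ?thesis by blast
  next
    case pB: False
    have dp': "card (nbrs E (X - {l}) p) \<le> 1"
    proof -
      have "nbrs E (X - {l}) p = nbrs E X p - {l}" "l \<in> nbrs E X p"
        using p lX by (auto simp: nbrs_def)
      then show ?thesis using dp finite_nbrs[OF fin, of E p] by simp
    qed
    have "forces_all E X B" unfolding forces_all_def
    proof (intro conjI allI impI)
      show "B \<subseteq> X" using BX by auto
      fix K assume K: "B \<subseteq> K" "K \<subset> X"
      \<comment> \<open>\<open>K\<close> may contain \<open>p\<close> without the neighbour that would have forced it. Whitening \<open>p\<close> again
      rules out that the force provided by \<open>B\<close> is performed by \<open>p\<close>.\<close>
      have "B \<subseteq> K - {l,p}" "K - {l,p} \<subset> X - {l}" using K BX pB p by auto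
      then obtain u w where u: "u \<in> K - {l,p}" and w: "nbrs E (X - {l} - (K - {l,p})) u = {w}"
        using forces_allD[OF B] by metis
      have uX: "u \<in> X" using u K by auto
      have ul: "\<not> E u l" using only[OF _ uX] u by auto
      have wE: "w \<in> X" "E u w" using w by (auto simp: nbrs_def)
      show "\<exists>u\<in>K. \<exists>w. nbrs E (X - K) u = {w}"
      proof (cases "p \<in> K \<and> w = p")
        case False
        \<comment> \<open>Unless \<open>p\<close> is the forced vertex, putting \<open>p\<close> and \<open>l\<close> back keeps the white neighbours of \<open>u\<close>.\<close>
        have "nbrs E (X - K) u = {w}"
        proof (cases "p \<in> K")
          case True
          then have "w \<noteq> p" using False by auto
          then have "w \<in> X - K" "\<not> E u p" using w p True
            by (auto simp: nbrs_def)
          then show ?thesis using w ul wE by (auto simp: nbrs_def)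
        next
          case False
          then show ?thesis using w ul wE p by (auto simp: nbrs_def)
        qed
        then show ?thesis using u by auto
      next
        case True
        show ?thesis
        proof (cases "l \<in> K")
          case False
          \<comment> \<open>Here \<open>u\<close> is blue and would force \<open>p\<close>, so \<open>u\<close> is the only neighbour of \<open>p\<close> besides \<open>l\<close>.\<close>
          have nbrs_p: "nbrs E (X - {l}) p = {u}"
            using dp' u uX wE True sym fin by (intro nbrs_eqI) (auto dest: sympD)
          have "v = l" if "v \<in> X - K" "E p v" for v
          proof (rule ccontr)
            assume "v \<noteq> l"
            then have "v \<in> nbrs E (X - {l}) p" using that by (simp add: nbrs_def)
            then have "v = u" using nbrs_p by simp
            then show False using that u by simp
          qed
          moreover have "l \<in> X - K" using lX False by simp
          ultimately have "nbrs E (X - K) p = {l}" using p(3) unfolding nbrs_def by blast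
          then show ?thesis using True by auto
        next
          case lK: True
          then have "insert l B \<subseteq> K" using K by auto
          then show ?thesis
            using forces_all_add_isolated[OF lX B] K(2) unfolding forces_all_def by blast
        qed
      qed
    qed
    then show ?thesis by blast
  qed
qed

text \<open>
  The blue leaf \<open>l1\<close> forces \<open>p\<close>. With \<open>p\<close> blue, the rest of the graph is forced as if \<open>p\<close> were absent, and
  in the end \<open>p\<close> has only \<open>l2\<close> left to force.
\<close>

lemma forces_all_extend_cherry:
  assumes sym: "symp E" and irr: "irreflp E"
    and l: "nbrs E X l1 = {p}" "nbrs E X l2 = {p}" "l1 \<in> X" "l2 \<in> X" "l1 \<noteq> l2"
    and B: "forces_all E (X - {l1, l2, p}) B"
  shows "forces_all E X (insert l1 B)"
  unfolding forces_all_def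
proof (intro conjI allI impI)
  show "insert l1 B \<subseteq> X" using B l by (auto simp: forces_all_def)
  have p: "p \<in> X" "E p l1" "E p l2" "E l1 p" "p \<noteq> l1" "p \<noteq> l2"
    using l sym irr by (auto simp: nbrs_def dest: sympD irreflpD)
  have only: "E v l2 \<Longrightarrow> v \<in> X \<Longrightarrow> v = p" for v
    using l sym by (auto simp: nbrs_def dest: sympD)
  fix K assume K: "insert l1 B \<subseteq> K" "K \<subset> X"
  consider "p \<notin> K" | "p \<in> K" "X - {l1,l2,p} \<subseteq> K" | "p \<in> K" "\<not> X - {l1,l2,p} \<subseteq> K" by blast
  then show "\<exists>u\<in>K. \<exists>w. nbrs E (X - K) u = {w}"
  proof cases
    case 1
    then have "nbrs E (X - K) l1 = {p}" using l by (auto simp: nbrs_def)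
    then show ?thesis using K by auto
  next
    case 2
    then have "X - K = {l2}" using K l by auto
    then have "nbrs E (X - K) p = {l2}" using p by (auto simp: nbrs_def)
    then show ?thesis using 2 by auto
  next
    case 3
    let ?K = "K \<inter> (X - {l1,l2,p})"
    have "B \<subseteq> ?K" "?K \<subset> X - {l1,l2,p}" using K B 3 by (auto simp: forces_all_def)
    then obtain u w where u: "u \<in> ?K" and w: "nbrs E (X - {l1,l2,p} - ?K) u = {w}"
      using forces_allD[OF B] by metis
    have "\<not> E u l2" using only u by auto
    then have "nbrs E (X - K) u = nbrs E (X - {l1,l2,p} - ?K) u" using 3 K by (auto simp: nbrs_def)
    then show ?thesis using u w by auto
  qed
qed

lemma one_degenerate_subset: "one_degenerate E X \<Longrightarrow> Y \<subseteq> X \<Longrightarrow> one_degenerate E Y"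
  by (auto simp: one_degenerate_def)

section \<open>Zero forcing in subcubic forests\<close>

text \<open>
  Suppose that the first two cases do not occur, so every leaf hangs at a vertex of degree 3. Removing
  all leaves leaves a nonempty forest, which has a vertex \<open>p\<close> with at most one neighbour in it.
  As \<open>p\<close> was not a leaf, it has lost a leaf neighbour, so it has degree 3, and at least two of its
  neighbours are leaves.
\<close>

lemma one_degenerate_cases:
  assumes sym: "symp E" and fin: "finite X" and ne: "X \<noteq> {}" and deg: "one_degenerate E X"
    and max3: "\<forall>v\<in>X. card (nbrs E X v) \<le> 3"
  obtains (isolated) l where "l \<in> X" "nbrs E X l = {}"
  | (leaf) l p where "l \<in> X" "nbrs E X l = {p}" "card (nbrs E X p) \<le> 2"
  | (cherry) l1 l2 p where "l1 \<in> X" "l2 \<in> X" "l1 \<noteq> l2" "p \<in> X" "card (nbrs E X p) = 3"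
      "nbrs E X l1 = {p}" "nbrs E X l2 = {p}"
proof (cases "\<exists>l\<in>X. nbrs E X l = {} \<or> (\<exists>p. nbrs E X l = {p} \<and> card (nbrs E X p) \<le> 2)")
  case True
  then show ?thesis using isolated leaf by blast
next
  case False
  define L where "L = {l \<in> X. card (nbrs E X l) \<le> 1}"
  have nbr_leaf: "card (nbrs E X p) = 3 \<and> nbrs E X l = {p}" if l: "l \<in> L" "p \<in> X" "E l p" for l p
  proof -
    have "nbrs E X l = {p}" using l fin by (intro nbrs_eqI) (auto simp: L_def)
    then show ?thesis using False l max3 unfolding L_def
      by (metis (no_types, lifting) One_nat_def Suc_1 le_SucE mem_Collect_eq numeral_3_eq_3)
  qed
  have "X - L \<noteq> {}"
  proof -
    obtain l where l: "l \<in> X" "card (nbrs E X l) \<le> 1"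
      using deg ne unfolding one_degenerate_def by blast
    then have "nbrs E X l \<noteq> {}" using False by blast
    then obtain p where "p \<in> X" "E l p" by (auto simp: nbrs_def)
    then have "card (nbrs E X p) = 3" using nbr_leaf[of l p] l by (auto simp: L_def)
    then show ?thesis using \<open>p \<in> X\<close> by (auto simp: L_def)
  qed
  then obtain p where p: "p \<in> X - L" "card (nbrs E (X - L) p) \<le> 1"
    using deg unfolding one_degenerate_def by (meson Diff_subset)
  have split: "nbrs E X p = nbrs E (X - L) p \<union> nbrs E L p"
    by (auto simp: nbrs_def L_def)
  have finL: "finite L" using fin by (simp add: L_def)
  have "nbrs E L p \<noteq> {}"
  proof
    assume "nbrs E L p = {}"
    then show False using split p by (auto simp: L_def)
  qed
  then obtain l where "l \<in> L" "E p l" by (auto simp: nbrs_def)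
  then have d3: "card (nbrs E X p) = 3" using nbr_leaf[of l p] p sym by (auto dest: sympD)
  have "card (nbrs E X p) \<le> card (nbrs E (X - L) p) + card (nbrs E L p)"
    unfolding split by (rule card_Un_le)
  then have "2 \<le> card (nbrs E L p)" using d3 p by simp
  then obtain l1 l2 where "l1 \<in> nbrs E L p" "l2 \<in> nbrs E L p" "l1 \<noteq> l2"
    by (metis (no_types, lifting) card_2_iff insert_subset obtain_subset_with_card_n)
  then show ?thesis
    using cherry[of l1 l2 p] d3 p nbr_leaf sym by (auto simp: nbrs_def L_def dest: sympD)
qed

lemma subcubic_forest_forcing:
  assumes sym: "symp E" and irr: "irreflp E"
  shows "finite X \<Longrightarrow> one_degenerate E X \<Longrightarrow> \<forall>v\<in>X. card (nbrs E X v) \<le> 3 \<Longrightarrow>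
    \<exists>B J R. forces_all E X B \<and> branch_set E X J \<and> separated E X R \<and> card B \<le> card J + card R"
proof (induction "card X" arbitrary: X rule: less_induct)
  case less
  note fin = less.prems(1) and max3 = less.prems(3)
  have IH: "\<exists>B J R. forces_all E Y B \<and> branch_set E Y J \<and> separated E Y R \<and> card B \<le> card J + card R"
    if "Y \<subset> X" for Y
  proof (rule less.hyps)
    show "card Y < card X" using that fin by (rule psubset_card_mono[rotated])
    show "finite Y" using that fin by (auto intro: finite_subset)
    show "one_degenerate E Y" using that less.prems(2) by (auto intro: one_degenerate_subset)
    show "\<forall>v\<in>Y. card (nbrs E Y v) \<le> 3"
      using that max3 card_nbrs_mono[OF _ fin, of Y E] by (meson dual_order.trans psubsetE subsetD)
  qed
  show ?case
  proof (cases "X = {}")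
    case True
    then have "forces_all E X {}" "branch_set E X {}" "separated E X {}"
      by (auto simp: forces_all_def branch_set_def separated_def)
    then show ?thesis by (metis le_add1 card.empty)
  next
    case False
    from sym fin False less.prems(2) max3 show ?thesis
    proof (cases rule: one_degenerate_cases)
      case (isolated l)
      then have "X - {l} \<subset> X" by auto
      then obtain B J R where *: "forces_all E (X - {l}) B" "branch_set E (X - {l}) J"
        "separated E (X - {l}) R" "card B \<le> card J + card R" using IH by blast
      have "finite R" "l \<notin> R" using * fin by (auto simp: separated_def intro: finite_subset)
      moreover have "finite B" "l \<notin> B" using * fin by (auto simp: forces_all_def intro: finite_subset)
      ultimately have "card (insert l B) \<le> card J + card (insert l R)" using * by simp
      moreover have "forces_all E X (insert l B)" 
        using * isolated by (intro forces_all_add_isolated)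
      moreover have "separated E X (insert l R)"
        using * isolated fin sym irr by (intro separated_add_isolated)
      moreover have "branch_set E X J" 
        using * fin max3 by (auto intro: branch_set_mono)
      ultimately show ?thesis by blast
    next
      case (leaf l p)
      then have "X - {l} \<subset> X" by auto
      then obtain B J R where *: "forces_all E (X - {l}) B" "branch_set E (X - {l}) J"
        "separated E (X - {l}) R" "card B \<le> card J + card R" using IH by blast
      obtain B' where "forces_all E X B'" "card B' = card B"
        using forces_all_extend_leaf[OF sym irr fin leaf *(1)] by blast
      moreover have "separated E X R"
        using * leaf fin sym irr by (intro separated_add_leaf[of E X l R]) auto
      moreover have "branch_set E X J" 
        using * fin max3 by (auto intro: branch_set_mono)
      ultimately show ?thesis using *(4) by metis
    next
      case (cherry l1 l2 p)
      let ?Y = "X - {l1, l2, p}"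
      have pl: "E p l1" "E p l2" "p \<noteq> l1" "p \<noteq> l2"
        using cherry sym irr by (auto simp: nbrs_def dest: sympD irreflpD)
      have "?Y \<subset> X" using cherry by auto
      then obtain B J R where *: "forces_all E ?Y B" "branch_set E ?Y J"
        "separated E ?Y R" "card B \<le> card J + card R" using IH by blast
      have fB: "finite B" "l1 \<notin> B" and fJ: "finite J" "p \<notin> J"
        using * fin by (auto simp: forces_all_def branch_set_def intro: finite_subset)
      have "forces_all E X (insert l1 B)"
        using cherry * sym irr by (intro forces_all_extend_cherry[of E X l1 p l2 B])
      moreover have "branch_set E X (insert p J)"
      proof -
        have J: "branch_set E X J" using * fin max3 by (auto intro: branch_set_mono)
        \<comment> \<open>A neighbour of \<open>p\<close> has degree at most 2 once \<open>p\<close> is gone.\<close>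
        have "\<not> E p u" if u: "u \<in> J" for u
        proof
          assume "E p u"
          then have "p \<in> nbrs E X u - nbrs E ?Y u" 
            using sym cherry by (auto simp: nbrs_def dest: sympD)
          moreover have "nbrs E ?Y u \<subseteq> nbrs E X u" by (auto simp: nbrs_def)
          ultimately have "card (nbrs E ?Y u) < card (nbrs E X u)"
            by (intro psubset_card_mono finite_nbrs fin) auto
          then show False using u J *(2) by (auto simp: branch_set_def)
        qed
        then show ?thesis using J cherry sym irr
          by (auto simp: branch_set_def dest: sympD irreflpD)
      qed
      moreover have "separated E X R"
      proof -
        have e1: "X - {l1} - {l2} - {p} = ?Y" by auto
        \<comment> \<open>After its two leaves have been removed, \<open>p\<close> is itself a leaf or isolated.\<close>
        have "card (nbrs E (X - {l1} - {l2}) p) \<le> 1"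
        proof -
          have "nbrs E (X - {l1} - {l2}) p = nbrs E X p - {l1, l2}" by (auto simp: nbrs_def)
          moreover have "{l1, l2} \<subseteq> nbrs E X p" using pl cherry by (auto simp: nbrs_def)
          ultimately show ?thesis using cherry by (simp add: card_Diff_subset)
        qed
        then have "separated E (X - {l1} - {l2}) R"
          using separated_add_leaf[OF sym irr _ _ *(3)[folded e1]] fin by blast
        moreover have "card (nbrs E (X - {l1}) l2) \<le> 1"
          using card_nbrs_mono[of "X - {l1}" X E l2] cherry fin by simp
        ultimately have "separated E (X - {l1}) R"
          by (intro separated_add_leaf[OF sym irr, of "X - {l1}" l2]) (simp_all add: fin)
        then show ?thesis
          using cherry by (intro separated_add_leaf[OF sym irr fin, of l1]) simp_all
      qed
      moreover have "card (insert l1 B) \<le> card (insert p J) + card R" using fB fJ * by simp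
      ultimately show ?thesis by blast
    qed
  qed
qed


section \<open>Induced subgraphs, cycles and components\<close>

lemma (in graph) graph_induce: "graph (G \<restriction> X)" if "X \<subseteq> verts G"
proof -
  have ind: "induced_subgraph (G \<restriction> X) G" using that by (rule induced_induce)
  interpret K: digraph "G \<restriction> X" using ind by (rule digraphI_induced)
  show ?thesis
    using induced_graph_imp_symmetric[OF sym_arcs ind] by (rule K.graphI)
qed

lemma dominates_induce_iff: "u \<rightarrow>\<^bsub>G \<restriction> X\<^esub> v \<longleftrightarrow> u \<rightarrow>\<^bsub>G\<^esub> v \<and> u \<in> X \<and> v \<in> X"
  by (auto simp: arcs_ends_conv)

lemma (in graph) symp_dominates: "symp (dominates G)"
  using arcs_ends_symmetric[OF sym_arcs] by (auto intro: sympI)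

lemma (in graph) irreflp_dominates: "irreflp (dominates G)"
  using no_loops by (fastforce intro!: irreflpI simp: arcs_ends_conv)

text \<open>
  The first vertex \<open>u\<close> of a longest path has a neighbour \<open>w\<close> other than its successor on the path. By
  maximality \<open>w\<close> lies on the path, and the edge between \<open>w\<close> and \<open>u\<close> closes a cycle. Since \<open>w\<close> is not the
  successor of \<open>u\<close>, this is not just an edge traversed back and forth.
\<close>

lemma (in graph) ex_cycle_of_min_degree_2:
  assumes ne: "verts G \<noteq> {}" and deg: "\<And>v. v \<in> verts G \<Longrightarrow> 2 \<le> card (nbrs (dominates G) (verts G) v)"
  shows "\<exists>p. cycle p \<and> 3 \<le> length p"
proof -
  define P where "P p \<longleftrightarrow> (\<exists>u v. apath u p v)" for p
  from ne obtain z where "z \<in> verts G" by blast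
  then have "P []" by (auto simp: P_def apath_Nil_iff)
  moreover have "\<forall>p. P p \<longrightarrow> length p < card (verts G)"
    using length_apath_less by (auto simp: P_def)
  ultimately obtain p where p: "P p" "\<And>q. P q \<Longrightarrow> length q \<le> length p"
    using ex_has_greatest_nat[of P "[]" length "card (verts G)"] by blast
  then obtain u v where uv: "apath u p v" by (auto simp: P_def)
  then have uG: "u \<in> verts G" by (auto simp: apath_def awalk_def)
  \<comment> \<open>For the empty path \<open>hd p\<close> is an arbitrary arc; this does no harm, as the vertex is only avoided.\<close>
  have "\<not> nbrs (dominates G) (verts G) u \<subseteq> {head G (hd p)}"
  proof
    assume "nbrs (dominates G) (verts G) u \<subseteq> {head G (hd p)}"
    then have "card (nbrs (dominates G) (verts G) u) \<le> card {head G (hd p)}"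
      by (intro card_mono) auto
    then show False using deg[OF uG] by simp
  qed
  then obtain w where w: "w \<in> verts G" "u \<rightarrow> w" "w \<noteq> head G (hd p)"
    unfolding nbrs_def by blast
  have "w \<rightarrow> u" using w arcs_ends_symmetric[OF sym_arcs] by blast
  then obtain a where a: "a \<in> arcs G" "tail G a = w" "head G a = u"
    by (auto simp: arcs_ends_conv)
  have "w \<noteq> u" using no_loops[OF a(1)] a by simp
  have "w \<in> set (awalk_verts u p)"
  proof (rule ccontr)
    assume "w \<notin> set (awalk_verts u p)"
    then have "apath w (a # p) v" using a uv by (simp add: apath_Cons_iff)
    then have "P (a # p)" by (auto simp: P_def)
    then show False using p(2) by fastforce
  qed
  then obtain q r where qr: "p = q @ r" "awalk u q w" "awalk w r v"
    using awalk_decomp[OF awalkI_apath[OF uv]] by blast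
  have "distinct (awalk_verts u q)"
  proof -
    have "apath u (q @ r) v" using uv qr by simp
    then show ?thesis unfolding apath_append_iff by (simp add: apath_def)
  qed
  have "2 \<le> length q"
  proof (cases q)
    case Nil
    then show ?thesis using qr \<open>w \<noteq> u\<close> by (simp add: awalk_Nil_iff)
  next
    case (Cons e q')
    then show ?thesis using qr w by (cases q') (auto simp: awalk_simps)
  qed
  moreover have "cycle (a # q)"
    unfolding cycle_def using a qr \<open>distinct (awalk_verts u q)\<close> by (auto simp: awalk_Cons_iff)
  ultimately show ?thesis by (intro exI[of _ "a # q"]) simp
qed

lemma (in graph) one_degenerate_if_acyclic:
  assumes "acyclic_graph G" shows "one_degenerate (dominates G) (verts G)"
  unfolding one_degenerate_def
proof (intro allI impI)
  fix Y assume Y: "Y \<subseteq> verts G" "Y \<noteq> {}"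
  interpret K: graph "G \<restriction> Y" using Y by (intro graph_induce)
  have "subgraph (G \<restriction> Y) G" using Y by (intro subgraph_induce_subgraphI)
  then have "\<not> (\<exists>p. K.cycle p \<and> 3 \<le> length p)"
    using assms subgraph_cycle by (auto simp: acyclic_graph_def)
  then have "\<exists>v\<in>Y. \<not> 2 \<le> card (nbrs (dominates (G \<restriction> Y)) Y v)"
    using K.ex_cycle_of_min_degree_2 Y by auto
  moreover have "nbrs (dominates (G \<restriction> Y)) Y v = nbrs (dominates G) Y v" if "v \<in> Y" for v
    using that by (auto simp: nbrs_def dominates_induce_iff)
  ultimately show "\<exists>v\<in>Y. card (nbrs (dominates G) Y v) \<le> 1" by force
qed

lemma (in graph) card_separated_le_components:
  assumes "separated (dominates G) (verts G) R"
  shows "card R \<le> card (components G)"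
proof -
  have linked: "linked (dominates G) (verts G) a b" if "a \<rightarrow>\<^sup>* b" for a b
    using that unfolding reachable_def linked_def
    by (induction rule: rtrancl_on_induct) (auto intro: rtranclp.rtrancl_into_rtrancl)
  have RG: "R \<subseteq> verts G" using assms by (simp add: separated_def)
  have "inj_on scc_of R"
  proof (rule inj_onI)
    fix a b assume ab: "a \<in> R" "b \<in> R" "scc_of a = scc_of b"
    then have "b \<in> scc_of a" using in_scc_of_self RG by auto
    then show "a = b" using ab linked assms by (auto simp: scc_of_def separated_def)
  qed
  then have "card R \<le> card sccs_verts"
    using RG finite_sccs_verts by (intro card_inj_on_le) (auto intro: scc_of_in_sccs_verts)
  then show ?thesis by (simp add: card_sccs_verts components_eq_sccs)
qed

lemma (in graph) card_nbrs_eq_out_degree: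
  "card (nbrs (dominates G) (verts G) v) = out_degree G v"
proof -
  have "nbrs (dominates G) (verts G) v = head G ` out_arcs G v"
    by (auto simp: nbrs_def arcs_ends_conv)
  moreover have "inj_on (head G) (out_arcs G v)"
    using no_multi_arcs by (auto intro!: inj_onI simp: arc_to_ends_def)
  ultimately show ?thesis by (simp add: out_degree_def card_image)
qed

section \<open>The graph parameters\<close>

text \<open>
  As \<open>S\<close> is blue throughout, the white neighbours of a vertex outside \<open>S\<close> are its white neighbours in
  the graph induced by the complement of \<open>S\<close>.
\<close>

lemma (in graph) zero_forcing_set_if_forces_complement:
  assumes S: "S \<subseteq> verts G" and B: "forces_all (dominates G) (verts G - S) B"
  shows "zero_forcing_set G (S \<union> B)"
proof -
  have "(force_step G)\<^sup>*\<^sup>* K (verts G)" if "S \<union> B \<subseteq> K" "K \<subseteq> verts G" for K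
    using that
  proof (induction "card (verts G - K)" arbitrary: K rule: less_induct)
    case less
    show ?case
    proof (cases "K = verts G")
      case False
      have "B \<subseteq> verts G - S" using B by (simp add: forces_all_def)
      then have "B \<subseteq> K - S" using less.prems(1) by blast
      moreover have "K - S \<subset> verts G - S" using less.prems False by blast
      ultimately obtain u w where u: "u \<in> K - S" 
        and w: "nbrs (dominates G) (verts G - S - (K - S)) u = {w}"
        by (rule forces_allD[OF B])
      have "verts G - S - (K - S) = verts G - K" using less.prems by auto
      then have w': "nbrs (dominates G) (verts G - K) u = {w}" using w by simp
      moreover have "{v. u \<rightarrow> v \<and> v \<notin> K} = nbrs (dominates G) (verts G - K) u"
        by (auto simp: nbrs_def adj_in_verts)
      ultimately have "force_step G K (insert w K)" using u by (auto simp: force_step_def)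
      moreover have "w \<in> verts G - K" using w' by (auto simp: nbrs_def)
      then have "(force_step G)\<^sup>*\<^sup>* (insert w K) (verts G)"
        using less.prems by (intro less.hyps psubset_card_mono) auto
      ultimately show ?thesis by (rule converse_rtranclp_into_rtranclp)
    qed simp
  qed
  then show ?thesis using S B by (auto simp: zero_forcing_set_def forces_all_def)
qed

lemma (in graph) zero_forcing_number_le:
  assumes "zero_forcing_set G B" shows "zero_forcing_number G \<le> card B"
proof -
  have "{B. zero_forcing_set G B} \<subseteq> Pow (verts G)" by (auto simp: zero_forcing_set_def)
  then have "finite {B. zero_forcing_set G B}" by (rule finite_subset) simp
  then show ?thesis using assms unfolding zero_forcing_number_def by (intro Min_le) auto
qed

lemma (in graph) card_le_independence_number:
  assumes "independent_set G I" shows "card I \<le> independence_number G"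
proof -
  have "{I. independent_set G I} \<subseteq> Pow (verts G)" by (auto simp: independent_set_def)
  then have "finite {I. independent_set G I}" by (rule finite_subset) simp
  then show ?thesis using assms unfolding independence_number_def by (intro Max_ge) auto
qed

lemma (in graph) obtain_minimum_vertex_cover:
  obtains C where "vertex_cover G C" "card C = vertex_cover_number G"
proof -
  have "{C. vertex_cover G C} \<subseteq> Pow (verts G)" by (auto simp: vertex_cover_def)
  then have "finite {C. vertex_cover G C}" by (rule finite_subset) simp
  moreover have "vertex_cover G (verts G)" by (auto simp: vertex_cover_def adj_in_verts)
  ultimately have "vertex_cover_number G \<in> card ` {C. vertex_cover G C}"
    unfolding vertex_cover_number_def by (intro Min_in) auto
  then show ?thesis using that by auto
qed

section \<open>The bound on the zero forcing number\<close>

theorem theorem6: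
  fixes G :: "('a, 'b) pre_digraph" and S :: "'a set" and c :: nat
  assumes "graph G"
    and "cubic G"
    and "S \<subseteq> verts G"
    and "acyclic_graph (G \<restriction> (verts G - S))"
    and "card (components (G \<restriction> (verts G - S))) = c"
  shows "zero_forcing_number G \<le> independence_number G + vertex_cover_number (G \<restriction> S) + c"
proof -
  interpret graph G by fact
  define F where "F = verts G - S"
  interpret H: graph "G \<restriction> F" by (rule graph_induce) (auto simp: F_def)
  interpret GS: graph "G \<restriction> S" using assms(3) by (rule graph_induce)
  have finF: "finite F" by (simp add: F_def)
  have nbrs_F: "nbrs (dominates (G \<restriction> F)) Y v = nbrs (dominates G) Y v" if "Y \<subseteq> F" "v \<in> F" for Y v
    using that by (auto simp: nbrs_def dominates_induce_iff)
  have deg3: "card (nbrs (dominates G) (verts G) v) = 3" if "v \<in> F" for v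
    using assms(2) that by (auto simp: cubic_def card_nbrs_eq_out_degree F_def)
  have "\<forall>v\<in>F. card (nbrs (dominates (G \<restriction> F)) F v) \<le> 3"
  proof
    fix v assume "v \<in> F"
    then show "card (nbrs (dominates (G \<restriction> F)) F v) \<le> 3"
      using card_nbrs_mono[of F "verts G" "dominates G" v] deg3[of v] nbrs_F[of F v]
      by (simp add: F_def)
  qed
  moreover have "one_degenerate (dominates (G \<restriction> F)) F"
    using H.one_degenerate_if_acyclic assms(4) by (simp add: F_def)
  ultimately obtain B J R where
      B: "forces_all (dominates (G \<restriction> F)) F B" and J: "branch_set (dominates (G \<restriction> F)) F J"
    and R: "separated (dominates (G \<restriction> F)) F R" and card_B: "card B \<le> card J + card R"
    using subcubic_forest_forcing[OF H.symp_dominates H.irreflp_dominates finF] by blast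
  have JF: "J \<subseteq> F" using J by (simp add: branch_set_def)
  have "card R \<le> c"
    using H.card_separated_le_components R assms(5) by (simp add: F_def)
  have "forces_all (dominates G) F B"
    unfolding forces_all_def
  proof (intro conjI allI impI)
    show "B \<subseteq> F" using B by (simp add: forces_all_def)
    fix K assume "B \<subseteq> K" "K \<subset> F"
    then obtain u w where "u \<in> K" "nbrs (dominates (G \<restriction> F)) (F - K) u = {w}"
      using B by (elim forces_allD)
    then show "\<exists>u\<in>K. \<exists>w. nbrs (dominates G) (F - K) u = {w}"
      using \<open>K \<subset> F\<close> nbrs_F[of "F - K" u] by (metis Diff_subset psubset_imp_subset subsetD)
  qed
  then have "zero_forcing_set G (S \<union> B)"
    using assms(3) by (intro zero_forcing_set_if_forces_complement) (simp_all add: F_def)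
  then have "zero_forcing_number G \<le> card (S \<union> B)" by (rule zero_forcing_number_le)
  also have "\<dots> \<le> card S + card B" by (rule card_Un_le)
  finally have Z: "zero_forcing_number G \<le> card S + card B" .
  have finS: "finite S" using assms(3) by (rule finite_subset) simp
  obtain C where C: "vertex_cover (G \<restriction> S) C" "card C = vertex_cover_number (G \<restriction> S)"
    by (rule GS.obtain_minimum_vertex_cover)
  have CS: "C \<subseteq> S" using C(1) by (simp add: vertex_cover_def)
  \<comment> \<open>The three neighbours of \<open>v\<close> in \<open>F\<close> are all its neighbours, as \<open>G\<close> is cubic.\<close>
  have J_nbrs: "w \<in> F" if "v \<in> J" "v \<rightarrow>\<^bsub>G\<^esub> w" for v w
  proof -
    have "v \<in> F" using that JF by blast
    have "card (nbrs (dominates (G \<restriction> F)) F v) = 3"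
      using J that(1) unfolding branch_set_def by blast
    then have "card (nbrs (dominates G) F v) = card (nbrs (dominates G) (verts G) v)"
      using nbrs_F[of F v] deg3[of v] \<open>v \<in> F\<close> by simp
    then have "nbrs (dominates G) F v = nbrs (dominates G) (verts G) v"
      by (intro card_subset_eq finite_nbrs) (auto simp: nbrs_def F_def)
    moreover have "w \<in> nbrs (dominates G) (verts G) v"
      using that by (auto simp: nbrs_def adj_in_verts)
    ultimately show ?thesis using nbrs_subset by fast
  qed
  have "independent_set G ((S - C) \<union> J)"
    unfolding independent_set_def
  proof (intro conjI ballI)
    show "(S - C) \<union> J \<subseteq> verts G" using assms(3) JF by (auto simp: F_def)
    fix u v assume uv: "u \<in> (S - C) \<union> J" "v \<in> (S - C) \<union> J"
    show "\<not> u \<rightarrow>\<^bsub>G\<^esub> v"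
    proof
      assume "u \<rightarrow>\<^bsub>G\<^esub> v"
      then have "v \<rightarrow>\<^bsub>G\<^esub> u" using symp_dominates by (auto dest: sympD)
      consider "u \<in> S - C" "v \<in> S - C" | "u \<in> J" "v \<in> J" | "u \<in> J" "v \<in> S" | "v \<in> J" "u \<in> S"
        using uv by blast
      then show False
      proof cases
        case 1
        then show ?thesis using C(1) \<open>u \<rightarrow>\<^bsub>G\<^esub> v\<close> by (auto simp: vertex_cover_def dominates_induce_iff)
      next
        case 2
        then show ?thesis using J JF \<open>u \<rightarrow>\<^bsub>G\<^esub> v\<close> by (auto simp: branch_set_def dominates_induce_iff)
      next
        case 3
        then show ?thesis using J_nbrs \<open>u \<rightarrow>\<^bsub>G\<^esub> v\<close> by (auto simp: F_def)
      next
        case 4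
        then show ?thesis using J_nbrs \<open>v \<rightarrow>\<^bsub>G\<^esub> u\<close> by (auto simp: F_def)
      qed
    qed
  qed
  then have "card ((S - C) \<union> J) \<le> independence_number G" by (rule card_le_independence_number)
  moreover have "card ((S - C) \<union> J) = card (S - C) + card J"
    using finS finF JF by (intro card_Un_disjoint) (auto simp: F_def intro: finite_subset)
  moreover have "card S = card (S - C) + card C"
    using CS finS by (metis card_Diff_subset card_mono finite_subset le_add_diff_inverse2)
  ultimately show ?thesis using Z card_B \<open>card R \<le> c\<close> C(2) by simp
qed

end
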